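(* Let $A\in\mathbb{R}^{m\times n}$, $D\in\mathbb{R}^{p\times n}$, $\bar x\in\{0,1\}^n$, and let $\Lambda:=\{i\in\{1,\dots,p\}:(D\bar x)_i=0\}$, $\Lambda^c:=\{1,\dots,p\}\setminus\Lambda$. Let $\Psi\in\mathbb{R}^{n\times n}$ be the diagonal matrix with $\Psi_{ii}=-1$ if $\bar x_i=0$ and $\Psi_{ii}=1$ if $\bar x_i=1$. Then $\bar x$ is the unique solution of $$\min_{x\in\mathbb{R}^n}\ \|Dx\|_1+\delta_{[0,1]^n}(x)\quad\text{subject to}\quad Ax=A\bar x$$ if and only if both of the following conditions hold: (i) $\mathcal{N}(A)\cap\mathcal{N}(D_{\Lambda,\bullet})\cap\mathcal{N}(\Psi)=\{0\}$; (ii) there exist $\alpha\in\mathbb{R}^p$ and $\mu\in\mathbb{R}^n$ such that $D^\top\alpha+\Psi\mu\in\mathcal{R}(A^\top)$, $\alpha_{\Lambda^c}=\operatorname{sign}(D_{\Lambda^c,\bullet}\,\bar x)$, $\|\alpha_\Lambda\|_\infty<1$, and $\mu>0$.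
   Context: $\delta_C$ is the convex indicator function of $C$: $\delta_C(x)=0$ if $x\in C$ and $+\infty$ otherwise. $\mathcal{N}(\cdot)$ and $\mathcal{R}(\cdot)$ denote nullspace and range of a matrix. $D_{\Lambda,\bullet}$ is the submatrix of $D$ formed by the rows indexed by $\Lambda$; $\alpha_\Lambda$ is the subvector of $\alpha$ indexed by $\Lambda$. $\operatorname{sign}$ is applied componentwise. $\mu>0$ means every component is strictly positive. $\|\cdot\|_1$ is the $\ell_1$-norm and $\|\cdot\|_\infty$ the maximum norm (equal to $0$ for an empty vector). If $\Lambda$ is empty, $\mathcal{N}(D_{\Lambda,\bullet})=\mathbb{R}^n$. *)

theory Defs
  imports "HOL-Analysis.Analysis"
begin

definition l1_norm :: "real ^ 'n \<Rightarrow> real" where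
  "l1_norm x = (\<Sum>i\<in>UNIV. \<bar>x $ i\<bar>)"

definition convex_indicator :: "'a set \<Rightarrow> 'a \<Rightarrow> ereal" where
  "convex_indicator C x = (if x \<in> C then 0 else \<infinity>)"

definition nullspace :: "real ^ 'n ^ 'm \<Rightarrow> (real ^ 'n) set" where
  "nullspace A = {x. A *v x = 0}"

(* The null space of the submatrix of D formed by the rows with index in L. Since the
   columns are all kept, the entries of the product of that submatrix with x are the
   entries of D *v x with index in L; for L = {} the result is the whole space. *)
definition nullspace_rows :: "real ^ 'n ^ 'p \<Rightarrow> 'p set \<Rightarrow> (real ^ 'n) set" where
  "nullspace_rows D L = {x. \<forall>i\<in>L. (D *v x) $ i = 0}"

definition matrix_range :: "real ^ 'n ^ 'm \<Rightarrow> (real ^ 'm) set" where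
  "matrix_range A = range (\<lambda>x. A *v x)"

(* The maximum norm of the subvector of x indexed by L. All the absolute values are
   nonnegative, so inserting 0 only fixes the value 0 for the empty subvector. *)
definition max_norm_on :: "'p set \<Rightarrow> real ^ 'p \<Rightarrow> real" where
  "max_norm_on L x = Max (insert 0 ((\<lambda>i. \<bar>x $ i\<bar>) ` L))"

end

theory Submission
  imports Defs
begin

text \<open>
  Write \<open>f x = l1_norm (D *v x)\<close>, and call a direction \<open>u\<close> admissible if it lies in the null
  space of \<open>A\<close> and points into the cube at \<open>xbar\<close>, that is, if all entries of \<open>\<Psi> *v u\<close> are
  nonpositive. With \<open>s\<close> the sign vector of \<open>D *v xbar\<close>, the one-sided derivative of \<open>f\<close> at
  \<open>xbar\<close> in direction \<open>u\<close> is the sum of \<open>s $ i * (D *v u) $ i\<close> off \<open>\<Lambda>\<close> and of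
  \<open>\<bar>(D *v u) $ i\<bar>\<close> on \<open>\<Lambda>\<close>.

  A pair \<open>\<alpha>, \<mu>\<close> as in (ii) is a dual certificate of uniqueness: \<open>\<alpha>\<close> is a subgradient of the
  \<open>\<ell>\<^sub>1\<close>-norm at \<open>D *v xbar\<close>, so that moving from \<open>xbar\<close> by a feasible \<open>d\<close> raises \<open>f\<close> by at
  least \<open>\<alpha> \<bullet> (D *v d)\<close>. Membership in the range of the transpose of \<open>A\<close> turns this into
  \<open>- \<mu> \<bullet> (\<Psi> *v d)\<close>, which is positive unless \<open>d = 0\<close> because \<open>\<mu>\<close> is positive and \<open>\<Psi>\<close> is
  a signature matrix (\<open>unique_minimizer_if_certificate\<close>).

  For the converse the vectors \<open>D\<^sup>T \<alpha> + \<Psi> \<mu> - A\<^sup>T w\<close>, with \<open>\<alpha>\<close> and \<open>\<mu>\<close>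
  restricted as in (ii) and \<open>w\<close> arbitrary, form a convex set, and a certificate exists precisely
  when this set contains \<open>0\<close>. Otherwise the set lies on one side of a hyperplane through \<open>0\<close>.
  Since the bounds in (ii) are strict, weak separation already
  suffices: the normal vector of the hyperplane, negated, is a nonzero admissible direction in
  which the derivative of \<open>f\<close> is nonpositive
  (\<open>certificate_or_nonascent_direction\<close>). As \<open>f\<close> is piecewise linear, a short step in that
  direction produces a second minimizer (\<open>nonascent_step\<close>).

  Condition (i) follows from the invertibility of \<open>\<Psi>\<close>.
\<close>

section \<open>A theorem of the alternative\<close>

lemma inner_transpose_mult:
  fixes M :: "real ^ 'n ^ 'm"
  shows "(transpose M *v x) \<bullet> y = x \<bullet> (M *v y)"
  by (simp add: dot_lmul_matrix transpose_matrix_vector)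

lemma affine_nonneg_slope_nonneg:
  fixes a b :: real
  assumes "\<And>c. 0 \<le> c \<Longrightarrow> 0 \<le> a + c * b"
  shows "0 \<le> b"
proof (rule ccontr)
  assume "\<not> 0 \<le> b"
  moreover have "0 \<le> a + ((\<bar>a\<bar> + 1) / \<bar>b\<bar>) * b"
    by (rule assms) simp
  ultimately show False
    by (simp add: field_simps abs_if split: if_splits)
qed

lemma affine_nonneg_at_one:
  fixes a b :: real
  assumes "\<And>t. 0 \<le> t \<Longrightarrow> t < 1 \<Longrightarrow> 0 \<le> a + t * b"
  shows "0 \<le> a + b"
proof -
  have "((\<lambda>t. a + t * b) \<longlongrightarrow> a + 1 * b) (at_left 1)"
    by (intro tendsto_intros)
  moreover have "\<forall>\<^sub>F t in at_left 1. 0 \<le> a + t * b"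
    using eventually_at_left_real[OF zero_less_one] by eventually_elim (auto intro: assms)
  ultimately have "0 \<le> a + 1 * b"
    by (rule tendsto_lowerbound) simp
  then show ?thesis by simp
qed

text \<open>
  The normal vector \<open>v\<close> of a hyperplane that separates \<open>0\<close> from the candidate vectors satisfies
  \<open>0 \<le> \<alpha> \<bullet> (D *v v) + \<mu> \<bullet> (transpose P *v v) - w \<bullet> (A *v v)\<close> for all admitted
  \<open>\<alpha>\<close>, \<open>\<mu>\<close>, \<open>w\<close>. Each parameter can be pushed to the end of its range separately: \<open>w\<close> to infinity
  forces \<open>A *v v = 0\<close>, an entry of \<open>\<mu>\<close> to infinity forces the entry of \<open>transpose P *v v\<close> to be
  nonnegative, and letting \<open>\<mu>\<close> tend to \<open>0\<close> and \<open>\<alpha>\<close> to the least favourable signs on \<open>L\<close> gives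
  the last inequality.
\<close>

lemma certificate_or_nonascent_direction:
  fixes A :: "real ^ 'n ^ 'm" and D :: "real ^ 'n ^ 'p" and P :: "real ^ 'q ^ 'n"
    and s :: "real ^ 'p" and L :: "'p set"
  obtains (certificate) \<alpha> \<mu> where
      "transpose D *v \<alpha> + P *v \<mu> \<in> matrix_range (transpose A)"
      "\<forall>i\<in>- L. \<alpha> $ i = s $ i" "\<forall>i\<in>L. \<bar>\<alpha> $ i\<bar> < 1" "\<forall>i. 0 < \<mu> $ i"
  | (direction) u where
      "u \<noteq> 0" "A *v u = 0" "\<forall>i. (transpose P *v u) $ i \<le> 0"
      "(\<Sum>i\<in>- L. s $ i * (D *v u) $ i) + (\<Sum>i\<in>L. \<bar>(D *v u) $ i\<bar>) \<le> 0"
proof -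
  define Q where "Q = {\<alpha>::real^'p. \<forall>i. \<alpha> $ i \<in> (if i \<in> L then {-1<..<1} else {s $ i})}"
  define R where "R = {\<mu>::real^'q. \<forall>i. \<mu> $ i \<in> {0<..}}"
  define F where "F = (\<lambda>(\<alpha>, \<mu>, w). transpose D *v \<alpha> + P *v \<mu> - transpose A *v w)"
  define S where "S = F ` (Q \<times> R \<times> (UNIV :: (real^'m) set))"
  have "convex Q"
    unfolding Q_def by (rule convex_box_cart) auto
  moreover have "convex R"
    unfolding R_def by (rule convex_box_cart) (simp only: Collect_mem_eq convex_real_interval)
  moreover have "linear F"
    unfolding F_def
    by (rule linearI)
       (auto simp: matrix_vector_right_distrib matrix_vector_mult_scaleR algebra_simps
          simp del: transpose_matrix_vector)
  ultimately have "convex S"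
    unfolding S_def by (intro convex_linear_image convex_Times convex_UNIV)
  show thesis
  proof (cases "0 \<in> S")
    case True
    then obtain \<alpha> \<mu> w where
      "\<alpha> \<in> Q" "\<mu> \<in> R" "transpose D *v \<alpha> + P *v \<mu> = transpose A *v w"
      unfolding S_def F_def by auto
    then show thesis
      by (intro certificate[of \<alpha> \<mu>])
         (auto simp: Q_def R_def matrix_range_def abs_less_iff split: if_splits dest: spec)
  next
    case False
    then obtain v where "v \<noteq> 0" and supp: "\<forall>z\<in>S. 0 \<le> v \<bullet> z"
      using separating_hyperplane_set_0[OF \<open>convex S\<close>] by blast
    have nonneg: "0 \<le> \<alpha> \<bullet> (D *v v) + \<mu> \<bullet> (transpose P *v v) - w \<bullet> (A *v v)"
      if "\<alpha> \<in> Q" "\<mu> \<in> R" for \<alpha> \<mu> w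
    proof -
      have "F (\<alpha>, \<mu>, w) \<in> S"
        unfolding S_def using that by blast
      then have "0 \<le> F (\<alpha>, \<mu>, w) \<bullet> v"
        using supp by (metis inner_commute)
      moreover have "(P *v \<mu>) \<bullet> v = \<mu> \<bullet> (transpose P *v v)"
        using inner_transpose_mult[of "transpose P" \<mu> v] by simp
      ultimately show ?thesis
        by (simp add: F_def inner_add_left inner_diff_left dot_lmul_matrix)
    qed
    (* The admitted values of alpha approaching, as t tends to 1, the one that minimizes
       its inner product with D *v v. *)
    define \<beta> where "\<beta> t = (\<chi> i. if i \<in> L then - t * sgn ((D *v v) $ i) else s $ i)" for t
    have \<beta>: "\<beta> t \<in> Q" if "0 \<le> t" "t < 1" for t
      using that by (auto simp: Q_def \<beta>_def sgn_if)
    have one: "1 \<in> R"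
      by (simp add: R_def)
    have "A *v v = 0"
    proof -
      have "0 \<le> (\<beta> 0 \<bullet> (D *v v) + 1 \<bullet> (transpose P *v v)) + c * (- ((A *v v) \<bullet> (A *v v)))" for c
        using nonneg[OF \<beta>[of 0] one, of "c *\<^sub>R (A *v v)"] by simp
      then have "0 \<le> - ((A *v v) \<bullet> (A *v v))"
        by (rule affine_nonneg_slope_nonneg)
      then show ?thesis
        by (metis inner_eq_zero_iff inner_ge_zero neg_0_le_iff_le order_antisym)
    qed
    moreover have "0 \<le> (transpose P *v v) $ j" for j
    proof -
      have "0 \<le> (\<beta> 0 \<bullet> (D *v v) + 1 \<bullet> (transpose P *v v)) + c * (transpose P *v v) $ j"
        if "0 \<le> c" for c
      proof -
        have "1 + c *\<^sub>R axis j 1 \<in> R"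
          using that by (auto simp: R_def axis_def)
        from nonneg[OF \<beta>[of 0] this, of 0] show ?thesis
          by (simp add: inner_add_left inner_axis')
      qed
      then show ?thesis
        by (rule affine_nonneg_slope_nonneg)
    qed
    moreover have "0 \<le> (\<Sum>i\<in>- L. s $ i * (D *v v) $ i) - (\<Sum>i\<in>L. \<bar>(D *v v) $ i\<bar>)"
    proof -
      let ?o = "\<Sum>i\<in>- L. s $ i * (D *v v) $ i" and ?l = "\<Sum>i\<in>L. \<bar>(D *v v) $ i\<bar>"
      let ?p = "1 \<bullet> (transpose P *v v)"
      have eq: "\<beta> t \<bullet> (D *v v) = ?o - t * ?l" for t
      proof -
        have "\<beta> t \<bullet> (D *v v) = (\<Sum>i\<in>- L. \<beta> t $ i * (D *v v) $ i) + (\<Sum>i\<in>L. \<beta> t $ i * (D *v v) $ i)"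
          unfolding inner_vec_def inner_real_def
          using sum.subset_diff[of L UNIV "\<lambda>i. \<beta> t $ i * (D *v v) $ i"]
          by (simp add: Compl_eq_Diff_UNIV)
        also have "(\<Sum>i\<in>L. \<beta> t $ i * (D *v v) $ i) = - t * ?l"
          unfolding sum_distrib_left by (rule sum.cong) (auto simp: \<beta>_def abs_sgn mult_ac)
        also have "(\<Sum>i\<in>- L. \<beta> t $ i * (D *v v) $ i) = ?o"
          by (rule sum.cong) (auto simp: \<beta>_def)
        finally show ?thesis by simp
      qed
      have "0 \<le> (?o + ?p) + t * (- ?l - ?p)" if "0 \<le> t" "t < 1" for t
      proof -
        have "(1 - t) *\<^sub>R 1 \<in> R"
          using that by (simp add: R_def)
        from nonneg[OF \<beta>[OF that] this, of 0] show ?thesis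
          by (simp add: eq algebra_simps)
      qed
      then have "0 \<le> (?o + ?p) + (- ?l - ?p)"
        by (rule affine_nonneg_at_one)
      then show ?thesis by simp
    qed
    ultimately show thesis
      using \<open>v \<noteq> 0\<close> by (intro direction[of "- v"])
        (simp_all add: linear_neg[OF matrix_vector_mul_linear] sum_negf del: transpose_matrix_vector)
  qed
qed

section \<open>Minimizing over the cube at a vertex\<close>

lemma diagonal_matrix_mult:
  fixes d :: "'n::finite \<Rightarrow> real" and M :: "real ^ 'n ^ 'n"
  assumes "M = (\<chi> i j. if i = j then d i else 0)"
  shows "(M *v x) $ i = d i * x $ i"
  unfolding assms matrix_vector_mult_def by (simp add: if_distrib[of "\<lambda>c. c * _"] cong: if_cong)

text \<open>
  Along the ray \<open>y + t *\<^sub>R z\<close> each summand of the \<open>\<ell>\<^sub>1\<close>-norm is affine in \<open>t\<close> until a nonzero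
  entry of \<open>y\<close> changes its sign.
\<close>

lemma l1_norm_short_step:
  fixes y z :: "real ^ 'p"
  assumes "0 \<le> t" and "\<And>i. y $ i \<noteq> 0 \<Longrightarrow> t * \<bar>z $ i\<bar> \<le> \<bar>y $ i\<bar>"
  shows "l1_norm (y + t *\<^sub>R z) =
    l1_norm y + t * ((\<Sum>i\<in>- {i. y $ i = 0}. sgn (y $ i) * z $ i) + (\<Sum>i\<in>{i. y $ i = 0}. \<bar>z $ i\<bar>))"
proof -
  have "\<bar>y $ i + t * z $ i\<bar> = \<bar>y $ i\<bar> + t * (if y $ i = 0 then \<bar>z $ i\<bar> else sgn (y $ i) * z $ i)" for i
  proof (cases "y $ i = 0")
    case True
    then show ?thesis
      using assms(1) by (simp add: abs_mult)
  next
    case False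
    have "\<bar>t * z $ i\<bar> \<le> \<bar>y $ i\<bar>"
      using assms(2)[OF False] assms(1) by (simp add: abs_mult)
    then show ?thesis
      using False by (auto simp: sgn_if abs_if split: if_splits)
  qed
  then show ?thesis
    by (simp add: l1_norm_def sum.distrib sum_distrib_left[symmetric] sum.If_cases)
qed

lemma exists_short_step:
  fixes a b :: "'i::finite \<Rightarrow> real"
  assumes "\<And>i. 0 < b i"
  obtains t where "0 < t" "\<And>i. t * \<bar>a i\<bar> \<le> b i"
proof
  define t where "t = Min (range (\<lambda>i. b i / (1 + \<bar>a i\<bar>)))"
  have pos: "0 < 1 + \<bar>a i\<bar>" for i
    by (simp add: add_pos_nonneg)
  show "0 < t"
    unfolding t_def using assms pos by (subst Min_gr_iff) auto
  show "t * \<bar>a i\<bar> \<le> b i" for i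
  proof -
    have "t \<le> b i / (1 + \<bar>a i\<bar>)"
      unfolding t_def by (rule Min_le) auto
    then have "t * (1 + \<bar>a i\<bar>) \<le> b i"
      using pos[of i] by (simp add: pos_le_divide_eq)
    with \<open>0 < t\<close> show ?thesis
      by (simp add: distrib_left)
  qed
qed

lemma is_arg_min_plus_indicator_iff:
  fixes f :: "'a \<Rightarrow> real"
  assumes "\<exists>y\<in>C. P y"
  shows "is_arg_min (\<lambda>x. ereal (f x) + convex_indicator C x) P x \<longleftrightarrow>
    x \<in> C \<and> P x \<and> (\<forall>y\<in>C. P y \<longrightarrow> f x \<le> f y)"
  using assms
  by (cases "x \<in> C") (auto simp: is_arg_min_def convex_indicator_def not_less split: if_splits)

text \<open>
  The step length is limited by the nonzero entries of \<open>D *v x\<close>, which keep their signs, and by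
  the width of the cube; the two families of bounds are combined over a sum type.
\<close>

lemma nonascent_step:
  fixes A :: "real ^ 'n ^ 'm" and D :: "real ^ 'n ^ 'p" and x u :: "real ^ 'n"
  assumes vertex: "\<forall>i. x $ i \<in> {0, 1}"
    and "A *v u = 0" and inward: "\<forall>i. (if x $ i = 0 then - 1 else 1) * u $ i \<le> 0"
    and nonascent: "(\<Sum>i\<in>- {i. (D *v x) $ i = 0}. sgn ((D *v x) $ i) * (D *v u) $ i)
      + (\<Sum>i\<in>{i. (D *v x) $ i = 0}. \<bar>(D *v u) $ i\<bar>) \<le> 0"
  obtains t where "0 < t" "\<forall>i. (x + t *\<^sub>R u) $ i \<in> {0..1}" "A *v (x + t *\<^sub>R u) = A *v x"
    "l1_norm (D *v (x + t *\<^sub>R u)) \<le> l1_norm (D *v x)"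
proof -
  define a where "a = case_sum (\<lambda>i. (D *v u) $ i) (\<lambda>i. u $ i)"
  define b where "b = case_sum (\<lambda>i. if (D *v x) $ i = 0 then 1 else \<bar>(D *v x) $ i\<bar>) (\<lambda>i::'n. 1)"
  have "0 < b k" for k
    by (cases k) (auto simp: b_def)
  then obtain t where t: "0 < t" and bound: "\<And>k. t * \<bar>a k\<bar> \<le> b k"
    using exists_short_step by blast
  show thesis
  proof
    show "\<forall>i. (x + t *\<^sub>R u) $ i \<in> {0..1}"
    proof
      fix i
      have "t * \<bar>u $ i\<bar> \<le> 1"
        using bound[of "Inr i"] by (simp add: a_def b_def)
      then have le: "\<bar>t * u $ i\<bar> \<le> 1"
        using t by (simp add: abs_mult)
      show "(x + t *\<^sub>R u) $ i \<in> {0..1}"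
      proof (cases "x $ i = 0")
        case True
        then have "0 \<le> t * u $ i"
          using inward[rule_format, of i] t by simp
        with True le show ?thesis by simp
      next
        case False
        then have "t * u $ i \<le> 0"
          using inward[rule_format, of i] t by (simp add: mult_le_0_iff)
        moreover have "x $ i = 1"
          using vertex False by auto
        ultimately show ?thesis using le by simp
      qed
    qed
    show "A *v (x + t *\<^sub>R u) = A *v x"
      using assms(2) by (simp add: matrix_vector_right_distrib matrix_vector_mult_scaleR)
    have "t * \<bar>(D *v u) $ i\<bar> \<le> \<bar>(D *v x) $ i\<bar>" if "(D *v x) $ i \<noteq> 0" for i
      using bound[of "Inl i"] that by (simp add: a_def b_def)
    from l1_norm_short_step[of t "D *v x" "D *v u", OF _ this] nonascent t
    show "l1_norm (D *v (x + t *\<^sub>R u)) \<le> l1_norm (D *v x)"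
      by (simp add: matrix_vector_right_distrib matrix_vector_mult_scaleR mult_le_0_iff)
  qed (fact t)
qed

text \<open>
  A vector \<open>\<alpha>\<close> with entries of modulus at most \<open>1\<close> which agrees with the signs of \<open>D *v x\<close> where
  these are nonzero satisfies \<open>\<alpha> \<bullet> (D *v y) \<le> l1_norm (D *v y)\<close>, with equality at \<open>y = x\<close>.
  Along a feasible displacement \<open>d\<close> the linear minorant grows by
  \<open>\<alpha> \<bullet> (D *v d) = - \<mu> \<bullet> (P *v d)\<close>, a sum of nonnegative terms which is positive as soon as some
  entry of \<open>d\<close> does not vanish.
\<close>

lemma unique_minimizer_if_certificate:
  fixes A :: "real ^ 'n ^ 'm" and D :: "real ^ 'n ^ 'p" and x y :: "real ^ 'n"
    and P :: "real ^ 'n ^ 'n"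
  assumes vertex: "\<forall>i. x $ i \<in> {0, 1}"
    and P: "P = (\<chi> i j. if i = j then (if x $ i = 0 then - 1 else 1) else 0)"
    and range: "transpose D *v \<alpha> + P *v \<mu> \<in> matrix_range (transpose A)"
    and sign: "\<forall>i. (D *v x) $ i \<noteq> 0 \<longrightarrow> \<alpha> $ i = sgn ((D *v x) $ i)"
    and bound: "\<forall>i. \<bar>\<alpha> $ i\<bar> \<le> 1" and pos: "\<forall>i. 0 < \<mu> $ i"
    and feasible: "\<forall>i. y $ i \<in> {0..1}" "A *v y = A *v x" and "y \<noteq> x"
  shows "l1_norm (D *v x) < l1_norm (D *v y)"
proof -
  let ?d = "y - x"
  let ?s = "\<lambda>i. if x $ i = 0 then - 1 else 1 :: real"
  obtain w where w: "transpose D *v \<alpha> + P *v \<mu> = transpose A *v w"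
    using range by (auto simp: matrix_range_def)
  have Pd: "(P *v \<mu>) \<bullet> ?d = (\<Sum>i\<in>UNIV. \<mu> $ i * (?s i * ?d $ i))"
    by (simp add: inner_vec_def diagonal_matrix_mult[OF P] mult_ac)
  have inward: "?s i * ?d $ i \<le> 0" for i
    using vertex[rule_format, of i] feasible(1)[rule_format, of i] by auto
  obtain j where j: "?d $ j \<noteq> 0"
    using \<open>y \<noteq> x\<close> by (auto simp: vec_eq_iff)
  have "(\<Sum>i\<in>UNIV. \<mu> $ i * (?s i * ?d $ i)) < (\<Sum>i\<in>(UNIV::'n set). 0)"
  proof (rule sum_strict_mono_ex1)
    show "\<forall>i\<in>UNIV. \<mu> $ i * (?s i * ?d $ i) \<le> 0"
      using inward pos by (meson mult_nonneg_nonpos less_imp_le)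
    have "?s j * ?d $ j < 0"
      using inward[of j] j by (auto simp: less_le)
    then have "\<mu> $ j * (?s j * ?d $ j) < 0"
      using pos by (meson mult_pos_neg)
    then show "\<exists>i\<in>UNIV. \<mu> $ i * (?s i * ?d $ i) < 0"
      by blast
  qed simp
  with Pd have "(P *v \<mu>) \<bullet> ?d < 0"
    by simp
  moreover have "\<alpha> \<bullet> (D *v ?d) + (P *v \<mu>) \<bullet> ?d = 0"
  proof -
    have "\<alpha> \<bullet> (D *v ?d) + (P *v \<mu>) \<bullet> ?d = (transpose A *v w) \<bullet> ?d"
      unfolding w[symmetric] inner_add_left inner_transpose_mult ..
    also have "\<dots> = w \<bullet> (A *v ?d)"
      by (rule inner_transpose_mult)
    also have "A *v ?d = 0"
      using feasible(2) by (simp add: matrix_vector_mult_diff_distrib)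
    finally show ?thesis by simp
  qed
  ultimately have "\<alpha> \<bullet> (D *v x) < \<alpha> \<bullet> (D *v y)"
    by (simp add: matrix_vector_mult_diff_distrib inner_diff_right)
  moreover have "\<alpha> \<bullet> (D *v x) = l1_norm (D *v x)"
    unfolding inner_vec_def inner_real_def l1_norm_def
  proof (rule sum.cong)
    fix i
    show "\<alpha> $ i * (D *v x) $ i = \<bar>(D *v x) $ i\<bar>"
      using sign by (cases "(D *v x) $ i = 0") (auto simp: abs_sgn mult.commute)
  qed simp
  moreover have "\<alpha> \<bullet> (D *v y) \<le> l1_norm (D *v y)"
    unfolding inner_vec_def inner_real_def l1_norm_def
  proof (rule sum_mono)
    fix i
    have "\<alpha> $ i * (D *v y) $ i \<le> \<bar>\<alpha> $ i\<bar> * \<bar>(D *v y) $ i\<bar>"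
      by (metis abs_ge_self abs_mult)
    also have "\<dots> \<le> 1 * \<bar>(D *v y) $ i\<bar>"
      using bound by (intro mult_right_mono) auto
    finally show "\<alpha> $ i * (D *v y) $ i \<le> \<bar>(D *v y) $ i\<bar>"
      by simp
  qed
  ultimately show ?thesis by simp
qed

theorem corollary2p9:
  fixes A :: "real ^ 'n ^ 'm" and D :: "real ^ 'n ^ 'p" and xbar :: "real ^ 'n"
    and \<Lambda> :: "'p set" and \<Psi> :: "real ^ 'n ^ 'n"
  assumes "\<forall>i. xbar $ i \<in> {0, 1}"
    and "\<Lambda> = {i. (D *v xbar) $ i = 0}"
    and "\<Psi> = (\<chi> i j. if i = j then (if xbar $ i = 0 then - 1 else 1) else 0)"
  shows "{x. is_arg_min
               (\<lambda>x. ereal (l1_norm (D *v x)) + convex_indicator {x. \<forall>i. x $ i \<in> {0..1}} x)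
               (\<lambda>x. A *v x = A *v xbar) x} = {xbar}
    \<longleftrightarrow>
      nullspace A \<inter> nullspace_rows D \<Lambda> \<inter> nullspace \<Psi> = {0} \<and>
      (\<exists>(\<alpha> :: real ^ 'p) (\<mu> :: real ^ 'n).
         transpose D *v \<alpha> + \<Psi> *v \<mu> \<in> matrix_range (transpose A) \<and>
         (\<forall>i\<in>- \<Lambda>. \<alpha> $ i = sgn ((D *v xbar) $ i)) \<and>
         max_norm_on \<Lambda> \<alpha> < 1 \<and>
         (\<forall>i. 0 < \<mu> $ i))"
proof -
  let ?C = "{x :: real ^ 'n. \<forall>i. x $ i \<in> {0..1}}"
  let ?s = "\<chi> i. sgn ((D *v xbar) $ i)"
  have cube: "xbar \<in> ?C"
    unfolding mem_Collect_eq
  proof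
    fix i
    show "xbar $ i \<in> {0..1}"
      using assms(1)[rule_format, of i] by auto
  qed
  have minimizer_iff: "is_arg_min (\<lambda>x. ereal (l1_norm (D *v x)) + convex_indicator ?C x)
      (\<lambda>x. A *v x = A *v xbar) x \<longleftrightarrow>
      x \<in> ?C \<and> A *v x = A *v xbar \<and> (\<forall>y\<in>?C. A *v y = A *v xbar \<longrightarrow> l1_norm (D *v x) \<le> l1_norm (D *v y))"
    for x
    using cube by (intro is_arg_min_plus_indicator_iff) blast
  have \<Psi>_mult: "(\<Psi> *v x) $ i = (if xbar $ i = 0 then - 1 else 1) * x $ i" for x i
    by (rule diagonal_matrix_mult[OF assms(3)])
  have "x = 0" if "\<Psi> *v x = 0" for x
    unfolding vec_eq_iff
  proof
    fix i
    have "(\<Psi> *v x) $ i = 0"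
      using that by simp
    then show "x $ i = 0 $ i"
      by (simp add: \<Psi>_mult split: if_splits)
  qed
  then have kernel: "nullspace A \<inter> nullspace_rows D \<Lambda> \<inter> nullspace \<Psi> = {0}"
    by (auto simp: nullspace_def nullspace_rows_def)
  have symmetric: "transpose \<Psi> = \<Psi>"
    by (auto simp: assms(3) transpose_def vec_eq_iff)
  have norm_iff: "max_norm_on \<Lambda> \<alpha> < 1 \<longleftrightarrow> (\<forall>i\<in>\<Lambda>. \<bar>\<alpha> $ i\<bar> < 1)" for \<alpha>
    by (simp add: max_norm_on_def)
  show ?thesis (is "?unique \<longleftrightarrow> _ \<and> ?certificate")
  proof (intro iffI conjI)
    show "nullspace A \<inter> nullspace_rows D \<Lambda> \<inter> nullspace \<Psi> = {0}"
      by (fact kernel)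
  next
    assume ?unique
    then have min_iff: "(x \<in> ?C \<and> A *v x = A *v xbar \<and>
        (\<forall>y\<in>?C. A *v y = A *v xbar \<longrightarrow> l1_norm (D *v x) \<le> l1_norm (D *v y))) \<longleftrightarrow> x = xbar" for x
      unfolding minimizer_iff by blast
    from certificate_or_nonascent_direction[where A = A and D = D and P = \<Psi> and s = ?s and L = \<Lambda>]
    show ?certificate
    proof cases
      case (certificate \<alpha> \<mu>)
      then show ?thesis
        unfolding norm_iff by (intro exI[of _ \<alpha>] exI[of _ \<mu>]) simp
    next
      case (direction u)
      obtain t where t: "0 < t" "xbar + t *\<^sub>R u \<in> ?C" "A *v (xbar + t *\<^sub>R u) = A *v xbar"
        "l1_norm (D *v (xbar + t *\<^sub>R u)) \<le> l1_norm (D *v xbar)"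
        using direction(3,4) nonascent_step[OF assms(1) direction(2), of D]
        by (auto simp: symmetric \<Psi>_mult assms(2))
      have "\<forall>y\<in>?C. A *v y = A *v xbar \<longrightarrow> l1_norm (D *v (xbar + t *\<^sub>R u)) \<le> l1_norm (D *v y)"
        using min_iff[of xbar] t(4) by (meson order_trans)
      with t(2,3) have "xbar + t *\<^sub>R u = xbar"
        using min_iff by blast
      with \<open>0 < t\<close> \<open>u \<noteq> 0\<close> show ?thesis
        by simp
    qed
  next
    assume "nullspace A \<inter> nullspace_rows D \<Lambda> \<inter> nullspace \<Psi> = {0} \<and> ?certificate"
    then obtain \<alpha> \<mu> where range: "transpose D *v \<alpha> + \<Psi> *v \<mu> \<in> matrix_range (transpose A)"
      and sign: "\<forall>i\<in>- \<Lambda>. \<alpha> $ i = sgn ((D *v xbar) $ i)"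
      and norm: "\<forall>i\<in>\<Lambda>. \<bar>\<alpha> $ i\<bar> < 1" and pos: "\<forall>i. 0 < \<mu> $ i"
      unfolding norm_iff by blast
    have signs: "\<forall>i. (D *v xbar) $ i \<noteq> 0 \<longrightarrow> \<alpha> $ i = sgn ((D *v xbar) $ i)"
      using sign assms(2) by auto
    have "\<bar>\<alpha> $ i\<bar> \<le> 1" for i
      using norm sign by (cases "i \<in> \<Lambda>") (auto simp: less_imp_le abs_sgn_eq)
    then have less: "l1_norm (D *v xbar) < l1_norm (D *v y)"
      if "y \<in> ?C" "A *v y = A *v xbar" "y \<noteq> xbar" for y
      using unique_minimizer_if_certificate[OF assms(1,3) range signs _ pos] that by blast
    have le: "l1_norm (D *v xbar) \<le> l1_norm (D *v y)" if "y \<in> ?C" "A *v y = A *v xbar" for y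
      using less[OF that] by (cases "y = xbar") (blast intro: less_imp_le, simp)
    have "x = xbar" if "x \<in> ?C" "A *v x = A *v xbar" "l1_norm (D *v x) \<le> l1_norm (D *v xbar)" for x
      using less[OF that(1,2)] that(3) by (meson not_less)
    with cube le show ?unique
      unfolding minimizer_iff by blast
  qed
qed

end
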